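(* Let $f:\mathbb{B}^n \to \mathbb{B}^N$ be holomorphic. If $\Gamma_f$ contains the center of the unitary group $\mathbf{U}(n)$ (that is, all maps $z \mapsto e^{i\theta}z$, $\theta\in\mathbb{R}$), then $f$ is spherically equivalent to a polynomial map.
   Context: $\mathbb{B}^k$ is the open unit ball in $\mathbb{C}^k$, $\mathrm{Aut}(\mathbb{B}^k)$ is its group of holomorphic automorphisms, and $\mathbf{U}(n)\subseteq \mathrm{Aut}(\mathbb{B}^n)$ is the unitary group. For holomorphic $f:\mathbb{B}^n\to\mathbb{B}^N$, let $A_f$ be the group of pairs $(\gamma,\psi)\in \mathrm{Aut}(\mathbb{B}^n)\times\mathrm{Aut}(\mathbb{B}^N)$ with $f\circ\gamma=\psi\circ f$, and let $\Gamma_f$ be the projection of $A_f$ to the first factor, i.e. $\Gamma_f=\{\gamma\in\mathrm{Aut}(\mathbb{B}^n): \exists\,\psi\in\mathrm{Aut}(\mathbb{B}^N),\ f\circ\gamma=\psi\circ f\}$. Holomorphic maps $f,g:\mathbb{B}^n\to\mathbb{B}^N$ are spherically equivalent if there are $\gamma\in\mathrm{Aut}(\mathbb{B}^n)$ and $\psi\in\mathrm{Aut}(\mathbb{B}^N)$ with $\psi\circ g=f\circ\gamma$. A map is polynomial if each of its components is a polynomial. *)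

theory Defs
  imports "HOL-Analysis.Analysis"
begin

text \<open>
  \<open>\<complex>\<^sup>k\<close> is \<^typ>\<open>complex^'k\<close>, whose norm is the Hermitian norm, so that
  \<open>\<bbbB>\<^sup>k\<close> is \<open>ball 0 1\<close>.  Functions are total; maps between balls
  are therefore considered only through their values on the ball.
\<close>

abbreviation unit_ball :: "(complex^'n) set" where
  "unit_ball \<equiv> ball 0 1"

text \<open>Holomorphy in several variables: Frechet differentiability with complex-linear derivative.\<close>

definition holomorphic_on_vec :: "(complex^'n \<Rightarrow> complex^'m) \<Rightarrow> (complex^'n) set \<Rightarrow> bool" where
  "holomorphic_on_vec f S \<longleftrightarrow>
     (\<forall>z\<in>S. \<exists>D. (f has_derivative D) (at z within S) \<and> Vector_Spaces.linear (*s) (*s) D)"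

definition holomorphic_ball_map :: "(complex^'n \<Rightarrow> complex^'m) \<Rightarrow> bool" where
  "holomorphic_ball_map f \<longleftrightarrow> holomorphic_on_vec f unit_ball \<and> f \<in> unit_ball \<rightarrow> unit_ball"

definition Aut_ball :: "(complex^'n \<Rightarrow> complex^'n) set" where
  "Aut_ball = {\<gamma>. holomorphic_ball_map \<gamma> \<and>
     (\<exists>\<delta>. holomorphic_ball_map \<delta> \<and>
        (\<forall>z\<in>unit_ball. \<delta> (\<gamma> z) = z) \<and> (\<forall>z\<in>unit_ball. \<gamma> (\<delta> z) = z))}"

definition A_group ::
  "(complex^'n \<Rightarrow> complex^'m) \<Rightarrow> ((complex^'n \<Rightarrow> complex^'n) \<times> (complex^'m \<Rightarrow> complex^'m)) set" where
  "A_group f = {(\<gamma>, \<psi>). \<gamma> \<in> Aut_ball \<and> \<psi> \<in> Aut_ball \<and>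
     (\<forall>z\<in>unit_ball. f (\<gamma> z) = \<psi> (f z))}"

definition Gamma_group :: "(complex^'n \<Rightarrow> complex^'m) \<Rightarrow> (complex^'n \<Rightarrow> complex^'n) set" where
  "Gamma_group f = fst ` A_group f"

definition spherically_equivalent ::
  "(complex^'n \<Rightarrow> complex^'m) \<Rightarrow> (complex^'n \<Rightarrow> complex^'m) \<Rightarrow> bool" where
  "spherically_equivalent f g \<longleftrightarrow>
     (\<exists>\<gamma>\<in>Aut_ball. \<exists>\<psi>\<in>Aut_ball. \<forall>z\<in>unit_ball. \<psi> (g z) = f (\<gamma> z))"

text \<open>Multi-indices are functions \<^typ>\<open>'n \<Rightarrow> nat\<close>; \<open>A\<close> is a finite set of them.\<close>

definition polynomial_function_vec :: "(complex^'n \<Rightarrow> complex) \<Rightarrow> bool" where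
  "polynomial_function_vec p \<longleftrightarrow>
     (\<exists>(A :: ('n \<Rightarrow> nat) set) c. finite A \<and>
        (\<forall>z. p z = (\<Sum>\<alpha>\<in>A. c \<alpha> * (\<Prod>i\<in>UNIV. (z $ i) ^ \<alpha> i))))"

definition polynomial_map :: "(complex^'n \<Rightarrow> complex^'m) \<Rightarrow> bool" where
  "polynomial_map p \<longleftrightarrow> (\<forall>j. polynomial_function_vec (\<lambda>z. p z $ j))"

definition adjoint_matrix :: "complex^'n^'n \<Rightarrow> complex^'n^'n" where
  "adjoint_matrix A = (\<chi> i j. cnj (A $ j $ i))"

definition unitary_group :: "(complex^'n^'n) set" where
  "unitary_group = {A. adjoint_matrix A ** A = mat 1 \<and> A ** adjoint_matrix A = mat 1}"

definition unitary_center :: "(complex^'n^'n) set" where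
  "unitary_center = {A \<in> unitary_group. \<forall>B\<in>unitary_group. A ** B = B ** A}"

lemma unitary_center_eq: "unitary_center = range (\<lambda>\<theta>. mat (cis \<theta>) :: complex^'n^'n)"
proof (intro set_eqI iffI)
  fix A :: "complex^'n^'n"
  assume A: "A \<in> unitary_center"
  have comm: "A ** B = B ** A" if "B \<in> unitary_group" for B
    using A that by (auto simp: unitary_center_def)
  define d :: "'n \<Rightarrow> complex^'n^'n"
    where "d k = (\<chi> i j. if i = j then (if i = k then -1 else 1) else 0)" for k
  define s :: "'n \<Rightarrow> 'n \<Rightarrow> complex^'n^'n"
    where "s k l = (\<chi> i j. if j = Transposition.transpose k l i then 1 else 0)" for k l
  have d: "d k \<in> unitary_group" for k
    by (auto simp: d_def unitary_group_def adjoint_matrix_def matrix_matrix_mult_def mat_def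
        vec_eq_iff if_distrib[of cnj] if_distrib[of "\<lambda>x. x * _"] sum.delta cong: if_cong)
  have tr: "(i = Transposition.transpose k l j) = (j = Transposition.transpose k l i)" for i j k l :: 'n
    by (metis transpose_involutory)
  have adj_s: "adjoint_matrix (s k l) = s k l" for k l
    by (auto simp: s_def adjoint_matrix_def vec_eq_iff tr)
  have s_mult: "(s k l ** B) $ i $ j = B $ Transposition.transpose k l i $ j" for k l B i j
    by (simp add: s_def matrix_matrix_mult_def if_distrib[of "\<lambda>x. x * _"] cong: if_cong)
  have mult_s: "(B ** s k l) $ i $ j = B $ i $ Transposition.transpose k l j" for k l B i j
    by (simp add: s_def matrix_matrix_mult_def if_distrib[of "\<lambda>x. _ * x"] tr[of j] cong: if_cong)
  have s: "s k l \<in> unitary_group" for k l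
  proof -
    have "s k l ** s k l = mat 1"
      by (simp add: vec_eq_iff s_mult) (simp add: s_def mat_def eq_commute)
    then show ?thesis by (simp add: unitary_group_def adj_s)
  qed
  have off: "A $ i $ j = 0" if "i \<noteq> j" for i j
  proof -
    have "(A ** d i) $ i $ j = A $ i $ j"
      using that by (simp add: d_def matrix_matrix_mult_def if_distrib[of "\<lambda>x. _ * x"] cong: if_cong)
    moreover have "(d i ** A) $ i $ j = - (A $ i $ j)"
      by (simp add: d_def matrix_matrix_mult_def if_distrib[of "\<lambda>x. x * _"] cong: if_cong)
    ultimately show ?thesis using comm[OF d, of i] by simp
  qed
  have diag: "A $ i $ i = A $ j $ j" for i j
    using s_mult[of i j A i j] mult_s[of A i j i j] comm[OF s, of i j] by simp
  define c where "c = A $ undefined $ undefined"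
  have Ac: "A = mat c"
    by (simp add: vec_eq_iff mat_def off) (metis c_def diag)
  have "A ** adjoint_matrix A = mat 1"
    using A by (simp add: unitary_center_def unitary_group_def)
  then have "(A ** adjoint_matrix A) $ undefined $ undefined = (mat 1 :: complex^'n^'n) $ undefined $ undefined"
    by simp
  then have "c * cnj c = 1"
    by (simp add: Ac mat_def adjoint_matrix_def matrix_matrix_mult_def
        if_distrib[of "\<lambda>x. x * _"] cong: if_cong)
  then have "cmod c = 1"
    by (metis complex_mod_mult_cnj norm_one power2_eq_1_iff norm_ge_zero not_one_le_zero
        neg_0_le_iff_le le_minus_one_simps(3))
  then show "A \<in> range (\<lambda>\<theta>. mat (cis \<theta>))"
    using Ac by (metis complex_norm_eq_1_exp cis_conv_exp rangeI)
next
  fix A :: "complex^'n^'n"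
  assume "A \<in> range (\<lambda>\<theta>. mat (cis \<theta>))"
  then obtain \<theta> where A: "A = mat (cis \<theta>)" by auto
  show "A \<in> unitary_center"
    by (auto simp: A unitary_center_def unitary_group_def adjoint_matrix_def mat_def vec_eq_iff
        matrix_matrix_mult_def if_distrib[of cnj] if_distrib[of "\<lambda>x. x * _"]
        if_distrib[of "\<lambda>x. _ * x"] cis_cnj cis_mult mult.commute cong: if_cong)
qed

text \<open>Hence the center of \<open>U(n)\<close>, as a set of maps, consists of the maps \<open>z \<mapsto> e\<^sup>i\<^sup>\<theta> z\<close>.\<close>

lemma unitary_center_maps:
  "(*v) ` (unitary_center :: (complex^'n^'n) set) = range (\<lambda>\<theta> z. cis \<theta> *s z)"
proof -
  have "(*v) (mat (cis \<theta>)) = (\<lambda>z :: complex^'n. cis \<theta> *s z)" for \<theta>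
    by (auto simp: fun_eq_iff vec_eq_iff matrix_vector_mult_def mat_def
        if_distrib[of "\<lambda>x. x * _"] cong: if_cong)
  then show ?thesis by (auto simp: unitary_center_eq image_image)
qed

end

theory Submission
  imports Defs "HOL-Complex_Analysis.Conformal_Mappings"
begin

text \<open>
  A rotation fixes \<open>0\<close>, so an automorphism \<open>\<psi>\<close> of the target ball with \<open>f (e\<^sup>i\<^sup>\<theta> z) = \<psi> (f z)\<close>
  fixes \<open>f 0\<close>.  Composing \<open>f\<close> with an involution of the ball that exchanges \<open>f 0\<close> and \<open>0\<close>
  (\<open>ball_involution\<close>) gives a map \<open>g\<close> for which all these automorphisms fix the origin, and such an
  automorphism is a unitary map (\<open>Cartan_linear\<close>, from the equality case of the Schwarz
  lemma).  So for every \<open>\<theta>\<close> there is a unitary \<open>D\<close> with \<open>g (e\<^sup>i\<^sup>\<theta> z) = D (g z)\<close>.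

  Expand \<open>g\<close> into homogeneous components \<open>g\<^sub>k\<close>.  Comparison of degrees gives
  \<open>D (g\<^sub>k z) = e\<^sup>i\<^sup>k\<^sup>\<theta> g\<^sub>k z\<close>: the values of \<open>g\<^sub>k\<close> are eigenvectors of \<open>D\<close>.  For two degrees \<open>k \<noteq> l\<close> some
  \<open>\<theta>\<close> separates the two eigenvalues, and eigenvectors of a unitary map for different
  eigenvalues are orthogonal.  Since the target has finite dimension, only finitely many
  components can be nonzero (\<open>finitely_many_hom_components\<close>), and \<open>g\<close> is a polynomial map.

  That each \<open>g\<^sub>k\<close> is a polynomial in the coordinates is derived from one-variable theory only.
  The component extends by homogeneity to the whole space with growth \<open>|z|\<^sup>k\<close>, so by Liouville's
  theorem it is a polynomial of bounded degree in each coordinate separately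
  (\<open>homogeneous_holomorphic_polynomial\<close>).  A separately polynomial function of bounded degree
  is a polynomial, because its coefficients in one coordinate are fixed linear
  combinations of its values (\<open>separately_polynomial\<close>).
\<close>

section \<open>The Hermitian product on \<open>\<complex>\<^sup>k\<close>\<close>

definition herm :: "complex^'n \<Rightarrow> complex^'n \<Rightarrow> complex" where
  "herm z w = (\<Sum>i\<in>UNIV. z $ i * cnj (w $ i))"

lemma herm_simps:
  shows herm_add_left: "herm (x + y) w = herm x w + herm y w"
    and herm_diff_left: "herm (x - y) w = herm x w - herm y w"
    and herm_diff_right: "herm w (x - y) = herm w x - herm w y"
    and herm_smult_left: "herm (c *s x) w = c * herm x w"
    and herm_smult_right: "herm w (c *s x) = cnj c * herm w x"
    and herm_zero_left: "herm 0 w = 0"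
  by (simp_all add: herm_def sum.distrib sum_subtractf sum_distrib_left algebra_simps)

lemma herm_commute: "herm w z = cnj (herm z w)"
  by (simp add: herm_def mult.commute)

lemma inner_eq_Re_herm: "inner z w = Re (herm z w)"
  by (simp add: herm_def inner_vec_def inner_complex_def)

lemma herm_self: "herm z z = of_real ((norm z)\<^sup>2)"
  by (simp add: complex_eq_iff dot_square_norm flip: inner_eq_Re_herm)
    (simp add: herm_def)

lemma norm_smult: "norm (c *s x) = cmod c * norm (x :: complex^'n)"
proof -
  have "of_real ((norm (c *s x))\<^sup>2) = (of_real ((cmod c * norm x)\<^sup>2) :: complex)"
    by (simp only: herm_self[symmetric] power_mult_distrib of_real_mult complex_norm_square
        herm_smult_left herm_smult_right) (simp add: mult_ac)
  then show ?thesis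
    using of_real_eq_iff by (metis norm_ge_zero power2_eq_imp_eq mult_nonneg_nonneg)
qed

text \<open>Rotating \<open>z\<close> so that its product with \<open>w\<close> becomes real reduces the complex
  Cauchy--Schwarz inequality to the real one.\<close>

lemma cmod_herm_le: "cmod (herm z w) \<le> norm z * norm w"
proof (cases "herm z w = 0")
  case False
  define u where "u = cnj (sgn (herm z w))"
  have u: "cmod u = 1" using False by (simp add: u_def norm_sgn)
  have "u * herm z w = of_real (cmod (herm z w))"
    using False by (simp add: u_def sgn_eq field_simps complex_norm_square[symmetric] power2_eq_square)
  then have "cmod (herm z w) = inner (u *s z) w"
    by (simp add: inner_eq_Re_herm herm_smult_left)
  also have "\<dots> \<le> norm (u *s z) * norm w"
    by (rule norm_cauchy_schwarz)
  finally show ?thesis by (simp add: norm_smult u)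
qed simp

lemma norm_add_squared: "(norm (x + y))\<^sup>2 = (norm x)\<^sup>2 + (norm y)\<^sup>2 + 2 * Re (herm x y)"
  by (simp add: inner_eq_Re_herm[symmetric] power2_norm_eq_inner inner_add_left inner_add_right
      inner_commute)

lemma norm_diff_squared: "(norm (x - y))\<^sup>2 = (norm x)\<^sup>2 + (norm y)\<^sup>2 - 2 * Re (herm x y)"
  by (simp add: inner_eq_Re_herm[symmetric] power2_norm_eq_inner inner_diff_left inner_diff_right
      inner_commute)

lemma bounded_bilinear_smult:
  "bounded_bilinear ((*s) :: complex \<Rightarrow> complex^'n \<Rightarrow> complex^'n)"
proof
  show "\<exists>K. \<forall>c x. norm (c *s x :: complex^'n) \<le> norm c * norm x * K"
    by (intro exI[of _ 1]) (simp add: norm_smult)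
qed (simp_all add: vec_eq_iff algebra_simps)

lemma scaleR_eq_smult: "r *\<^sub>R x = of_real r *s (x :: complex^'n)"
  by (simp only: vec_eq_iff vector_scaleR_component vector_smult_component)
    (simp add: scaleR_conv_of_real)

lemma bounded_linear_herm: "bounded_linear (\<lambda>z. herm z w)"
proof (rule bounded_linear_intro[of _ "norm w"])
  show "herm (r *\<^sub>R x) w = r *\<^sub>R herm x w" for r x
    by (simp add: scaleR_eq_smult herm_smult_left scaleR_conv_of_real)
qed (simp_all add: herm_add_left cmod_herm_le)

section \<open>Holomorphic maps in several variables\<close>

lemma linear_smultI:
  assumes "\<And>x y. f (x + y) = f x + f y" "\<And>c x. f (c *s x) = c *s f x"
  shows "Vector_Spaces.linear (*s) (*s) (f :: complex^'n \<Rightarrow> complex^'m)"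
  using assms by (simp add: Vector_Spaces.linear_iff vec.vector_space_axioms)

lemma linear_smultD:
  assumes "Vector_Spaces.linear (*s) (*s) (f :: complex^'n \<Rightarrow> complex^'m)"
  shows "f (x + y) = f x + f y" "f (c *s x) = c *s f x"
  using assms by (simp_all add: Vector_Spaces.linear_iff)

lemma holomorphic_ball_mapD:
  assumes "holomorphic_ball_map f" "norm z < 1"
  shows "norm (f z) < 1"
  using assms by (auto simp: holomorphic_ball_map_def)

lemma holomorphic_ball_map_derivative:
  assumes "holomorphic_ball_map f" "norm z < 1"
  obtains D where "(f has_derivative D) (at z)" "Vector_Spaces.linear (*s) (*s) D"
proof -
  have "z \<in> unit_ball" using assms(2) by simp
  then show ?thesis
    using assms(1) at_within_open[OF _ open_ball, of z 0 1] that
    unfolding holomorphic_ball_map_def holomorphic_on_vec_def by metis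
qed

lemma holomorphic_ball_mapI:
  assumes "\<And>z. norm z < 1 \<Longrightarrow>
      \<exists>D. (f has_derivative D) (at z) \<and> Vector_Spaces.linear (*s) (*s) D"
    and "\<And>z. norm z < 1 \<Longrightarrow> norm (f z) < 1"
  shows "holomorphic_ball_map f"
  unfolding holomorphic_ball_map_def holomorphic_on_vec_def
proof (intro conjI ballI Pi_I)
  fix z :: "complex^'a" assume "z \<in> unit_ball"
  then have z: "norm z < 1" by simp
  show "\<exists>D. (f has_derivative D) (at z within unit_ball) \<and> Vector_Spaces.linear (*s) (*s) D"
    using assms(1)[OF z] has_derivative_at_withinI by blast
  show "f z \<in> unit_ball" using assms(2)[OF z] by simp
qed

lemma holomorphic_ball_map_cong:
  assumes "holomorphic_ball_map f" "\<And>z. norm z < 1 \<Longrightarrow> g z = f z"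
  shows "holomorphic_ball_map g"
proof (rule holomorphic_ball_mapI)
  fix z :: "complex^'a" assume z: "norm z < 1"
  obtain D where D: "(f has_derivative D) (at z)" "Vector_Spaces.linear (*s) (*s) D"
    by (rule holomorphic_ball_map_derivative[OF assms(1) z])
  have "(g has_derivative D) (at z)"
    using has_derivative_transform_within_open[OF D(1) open_ball[of 0 1], of g] z assms(2) by auto
  with D show "\<exists>D. (g has_derivative D) (at z) \<and> Vector_Spaces.linear (*s) (*s) D" by blast
  show "norm (g z) < 1"
    using assms z by (auto simp: holomorphic_ball_mapD)
qed

lemma holomorphic_ball_map_compose:
  assumes g: "holomorphic_ball_map g" and f: "holomorphic_ball_map f"
  shows "holomorphic_ball_map (g \<circ> f)"
proof (rule holomorphic_ball_mapI)
  fix z :: "complex^'c" assume z: "norm z < 1"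
  obtain D where D: "(f has_derivative D) (at z)" "Vector_Spaces.linear (*s) (*s) D"
    by (rule holomorphic_ball_map_derivative[OF f z])
  obtain E where E: "(g has_derivative E) (at (f z))" "Vector_Spaces.linear (*s) (*s) E"
    by (rule holomorphic_ball_map_derivative[OF g holomorphic_ball_mapD[OF f z]])
  show "\<exists>D. (g \<circ> f has_derivative D) (at z) \<and> Vector_Spaces.linear (*s) (*s) D"
    using diff_chain_at[OF D(1) E(1)] Vector_Spaces.linear_compose[OF D(2) E(2)] by blast
  show "norm ((g \<circ> f) z) < 1"
    using z by (simp add: holomorphic_ball_mapD[OF g] holomorphic_ball_mapD[OF f])
qed

lemma holomorphic_ball_map_id: "holomorphic_ball_map (\<lambda>z. z)"
  by (rule holomorphic_ball_mapI, intro exI conjI, rule has_derivative_ident, rule linear_smultI) auto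

lemma Aut_ball_id: "(\<lambda>z. z) \<in> Aut_ball"
  using holomorphic_ball_map_id unfolding Aut_ball_def by blast

lemma Aut_ball_compose:
  assumes "\<phi> \<in> Aut_ball" "\<psi> \<in> Aut_ball"
  shows "\<phi> \<circ> \<psi> \<in> Aut_ball"
proof -
  obtain \<phi>' where 1: "holomorphic_ball_map \<phi>" "holomorphic_ball_map \<phi>'"
      "\<forall>z\<in>unit_ball. \<phi>' (\<phi> z) = z" "\<forall>z\<in>unit_ball. \<phi> (\<phi>' z) = z"
    using assms(1) by (auto simp: Aut_ball_def)
  obtain \<psi>' where 2: "holomorphic_ball_map \<psi>" "holomorphic_ball_map \<psi>'"
      "\<forall>z\<in>unit_ball. \<psi>' (\<psi> z) = z" "\<forall>z\<in>unit_ball. \<psi> (\<psi>' z) = z"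
    using assms(2) by (auto simp: Aut_ball_def)
  show ?thesis
    unfolding Aut_ball_def
  proof (intro CollectI conjI exI[of _ "\<psi>' \<circ> \<phi>'"] holomorphic_ball_map_compose 1(1,2) 2(1,2))
    show "\<forall>z\<in>unit_ball. (\<psi>' \<circ> \<phi>') ((\<phi> \<circ> \<psi>) z) = z"
      using 1(3) 2(3) holomorphic_ball_mapD[OF 2(1)] by simp
    show "\<forall>z\<in>unit_ball. (\<phi> \<circ> \<psi>) ((\<psi>' \<circ> \<phi>') z) = z"
      using 1(4) 2(4) holomorphic_ball_mapD[OF 1(2)] by simp
  qed
qed

text \<open>The chain rule, with a complex-linear derivative, makes every component holomorphic along
  the complex lines in the ball; this is how one-variable theory is brought to bear.\<close>

lemma holomorphic_along_line:
  assumes f: "holomorphic_ball_map f" and T: "open T"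
    and sub: "\<And>t. t \<in> T \<Longrightarrow> norm (a + t *s b) < 1"
  shows "(\<lambda>t. f (a + t *s b) $ j) holomorphic_on T"
proof -
  have "(\<lambda>t. f (a + t *s b) $ j) field_differentiable at t" if t: "t \<in> T" for t
  proof -
    obtain D where D: "(f has_derivative D) (at (a + t *s b))" "Vector_Spaces.linear (*s) (*s) D"
      by (rule holomorphic_ball_map_derivative[OF f sub[OF t]])
    have "((\<lambda>t. a + t *s b) has_derivative (\<lambda>h. h *s b)) (at t)"
      by (rule has_derivative_eq_rhs, rule has_derivative_add[OF has_derivative_const
          bounded_linear_imp_has_derivative[OF bounded_bilinear.bounded_linear_left
            [OF bounded_bilinear_smult]]]) simp
    from bounded_linear.has_derivative[OF bounded_linear_vec_nth diff_chain_at[OF this D(1)]]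
    have "((\<lambda>t. f (a + t *s b) $ j) has_derivative (\<lambda>h. D (h *s b) $ j)) (at t)"
      by (simp add: o_def)
    moreover have "(\<lambda>h. D (h *s b) $ j) = (*) (D b $ j)"
      by (auto simp: linear_smultD[OF D(2)])
    ultimately show ?thesis
      by (auto simp: field_differentiable_def has_field_derivative_def)
  qed
  then show ?thesis
    using T by (simp add: holomorphic_on_def field_differentiable_at_within)
qed

section \<open>Moving a point of the ball to the origin\<close>

text \<open>This is the classical involution of the ball that exchanges \<open>a\<close> and \<open>0\<close>, namely
  \<open>z \<mapsto> (a - P z - s (z - P z)) / (1 - \<langle>z, a\<rangle>)\<close> with \<open>s = sqrt (1 - |a|\<^sup>2)\<close> and \<open>P\<close> the
  orthogonal projection onto the line of \<open>a\<close>.  Since \<open>(1 - s) / |a|\<^sup>2 = 1 / (1 + s)\<close>, the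
  projection can be written without dividing by \<open>|a|\<close>, so that \<open>a = 0\<close> is no exception.\<close>

definition ball_involution :: "complex^'n \<Rightarrow> complex^'n \<Rightarrow> complex^'n" where
  "ball_involution a z =
    (let s = of_real (sqrt (1 - (norm a)\<^sup>2)); c = herm z a
     in inverse (1 - c) *s ((1 - c / (1 + s)) *s a - s *s z))"


lemma one_minus_herm_nonzero:
  assumes "norm z < 1" "norm a < 1"
  shows "1 - herm z a \<noteq> 0"
proof -
  have "cmod (herm z a) \<le> norm z * norm a" by (rule cmod_herm_le)
  also have "\<dots> < 1" using assms mult_strict_mono'[of "norm z" 1 "norm a" 1] by simp
  finally show ?thesis by auto
qed

context
  fixes a :: "complex^'n" and s :: complex
  assumes a: "norm a < 1" and s: "s = of_real (sqrt (1 - (norm a)\<^sup>2))"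
begin

lemma involution_parameter:
  shows "of_real ((norm a)\<^sup>2) = 1 - s\<^sup>2" "s \<noteq> 0" "1 + s \<noteq> 0" "cnj s = s"
proof -
  have *: "(norm a)\<^sup>2 < 1" using a by (simp add: abs_square_less_1)
  then show "of_real ((norm a)\<^sup>2) = 1 - s\<^sup>2"
    by (simp add: s flip: of_real_power)
  show "s \<noteq> 0" using * by (simp add: s)
  have "Re (1 + s) > 0" using * by (simp add: s add_pos_pos)
  then show "1 + s \<noteq> 0" by (metis less_irrefl zero_complex.simps(1))
  show "cnj s = s" by (simp add: s)
qed

lemma ball_involution_eq:
  "ball_involution a z = inverse (1 - herm z a) *s ((1 - herm z a / (1 + s)) *s a - s *s z)"
  by (simp add: ball_involution_def Let_def s)

lemma herm_a_a: "herm a a = 1 - s\<^sup>2"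
  using involution_parameter(1) by (simp add: herm_self)

lemma one_minus_herm_involution:
  assumes z: "norm z < 1"
  shows "1 - herm (ball_involution a z) a = s\<^sup>2 / (1 - herm z a)"
proof -
  note nz = one_minus_herm_nonzero[OF z a] involution_parameter(3)
  have "herm (ball_involution a z) a
      = ((1 - herm z a / (1 + s)) * (1 - s\<^sup>2) - s * herm z a) / (1 - herm z a)"
    by (simp add: ball_involution_eq herm_simps herm_a_a divide_inverse algebra_simps)
  also have "(1 - herm z a / (1 + s)) * (1 - s\<^sup>2) = (1 - s\<^sup>2) - herm z a * (1 - s)"
    using nz(2) by (simp add: field_simps power2_eq_square) 
  finally show ?thesis using nz(1) by (simp add: field_simps)
qed

lemma ball_involution_involutive:
  assumes z: "norm z < 1"
  shows "ball_involution a (ball_involution a z) = z"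
proof -
  define c where "c = herm z a"
  have nz: "1 - c \<noteq> 0" "1 + s \<noteq> 0" "s \<noteq> 0"
    using one_minus_herm_nonzero[OF z a] involution_parameter by (auto simp: c_def)
  have c': "herm (ball_involution a z) a = 1 - s\<^sup>2 / (1 - c)"
    using one_minus_herm_involution[OF z] unfolding c_def by (simp add: algebra_simps)
  have comp: "ball_involution a w $ i
      = inverse (1 - herm w a) * ((1 - herm w a / (1 + s)) * a $ i - s * w $ i)" for w i
    by (simp only: ball_involution_eq vector_smult_component vector_minus_component)
  have key: "inverse (1 - (1 - s\<^sup>2 / d)) * ((1 - (1 - s\<^sup>2 / d) / (1 + s)) * x
      - s * (inverse d * ((1 - (1 - d) / (1 + s)) * x - s * y))) = y" if "d \<noteq> 0" for d x y
    using that nz(2,3) by (simp add: divide_simps power2_eq_square) (simp add: algebra_simps)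
  have "ball_involution a (ball_involution a z) $ i = z $ i" for i
    using key[OF nz(1), of "a $ i" "z $ i"] by (simp only: comp c') (simp add: c_def)
  then show ?thesis by (simp add: vec_eq_iff)
qed

text \<open>Expanding the squared norm of the numerator gives
  \<open>1 - |\<phi> z|\<^sup>2 = (1 - |a|\<^sup>2) (1 - |z|\<^sup>2) / |1 - \<langle>z, a\<rangle>|\<^sup>2\<close>, from which the involution preserves
  the ball.\<close>

lemma norm_ball_involution_less:
  assumes z: "norm z < 1"
  shows "norm (ball_involution a z) < 1"
proof -
  define c where "c = herm z a"
  define k where "k = 1 - c / (1 + s)"
  define n where "n = k *s a - s *s z"
  have nz: "1 - c \<noteq> 0" "1 + s \<noteq> 0" "s \<noteq> 0"
    using one_minus_herm_nonzero[OF z a] involution_parameter by (auto simp: c_def)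
  have cnjc: "herm a z = cnj c" by (simp add: c_def herm_commute[of a z])
  have nz': "1 + cnj s \<noteq> 0" using nz involution_parameter(4) by simp
  \<comment> \<open>Used with \<open>r = s\<close>, \<open>q = 1 / (1 + s)\<close>, \<open>d\<close> the conjugate of \<open>c\<close> and \<open>h = \<langle>z, z\<rangle>\<close>.\<close>
  have expand: "(1 - c * q) * (1 - d * q) * (1 - r\<^sup>2) - r * (1 - c * q) * d - r * (1 - d * q) * c + r\<^sup>2 * h
      = (1 - c) * (1 - d) - r\<^sup>2 * (1 - h)" if "q * (1 + r) = 1" for c d q r h :: complex
    using that by algebra
  have "of_real ((norm n)\<^sup>2) = herm n n"
    by (simp add: herm_self)
  also have "\<dots> = k * cnj k * (1 - s\<^sup>2) - s * k * cnj c - s * cnj k * c + s\<^sup>2 * herm z z"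
    by (simp add: n_def herm_simps herm_a_a cnjc c_def[symmetric] involution_parameter(4)
        algebra_simps power2_eq_square)
  also have "\<dots> = (1 - c) * (1 - cnj c) - s\<^sup>2 * (1 - herm z z)"
    using expand[of "inverse (1 + s)" s c "cnj c" "herm z z"] nz(2)
    by (simp add: k_def divide_inverse involution_parameter(4))
  also have "\<dots> = of_real ((cmod (1 - c))\<^sup>2 - (1 - (norm a)\<^sup>2) * (1 - (norm z)\<^sup>2))"
  proof -
    have "s\<^sup>2 = 1 - of_real ((norm a)\<^sup>2)" using involution_parameter(1) by simp
    moreover have "of_real ((cmod (1 - c))\<^sup>2) = (1 - c) * (1 - cnj c)"
      by (simp only: complex_norm_square complex_cnj_diff complex_cnj_one)
    ultimately show ?thesis
      by (simp only: herm_self of_real_diff of_real_mult of_real_1)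
  qed
  finally have "(norm n)\<^sup>2 = (cmod (1 - c))\<^sup>2 - (1 - (norm a)\<^sup>2) * (1 - (norm z)\<^sup>2)"
    using of_real_eq_iff by blast
  moreover have "(1 - (norm a)\<^sup>2) * (1 - (norm z)\<^sup>2) > 0"
    using a z by (simp add: abs_square_less_1)
  ultimately have "(norm n)\<^sup>2 < (cmod (1 - c))\<^sup>2" by simp
  then have "norm n < cmod (1 - c)" by (rule power2_less_imp_less) simp
  moreover have "ball_involution a z = inverse (1 - c) *s n"
    by (simp add: ball_involution_eq c_def n_def k_def)
  ultimately show ?thesis
    using nz(1) by (simp add: norm_smult norm_inverse norm_divide divide_simps)
qed

lemma holomorphic_ball_involution: "holomorphic_ball_map (ball_involution a)"
proof (rule holomorphic_ball_mapI)
  fix z :: "complex^'n" assume z: "norm z < 1"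
  define D where "D h =
      inverse (1 - herm z a) *s (- (herm h a / (1 + s)) *s a - s *s h)
      + (inverse (1 - herm z a) * herm h a * inverse (1 - herm z a))
          *s ((1 - herm z a / (1 + s)) *s a - s *s z)" for h
  note bl = bounded_bilinear.bounded_linear_left[OF bounded_bilinear_smult]
    bounded_bilinear.bounded_linear_right[OF bounded_bilinear_smult]
  have h: "((\<lambda>z. herm z a) has_derivative (\<lambda>h. herm h a)) (at z)"
    by (rule bounded_linear_imp_has_derivative[OF bounded_linear_herm])
  have q: "((\<lambda>z. 1 - herm z a / (1 + s)) has_derivative (\<lambda>h. - (herm h a / (1 + s)))) (at z)"
    using involution_parameter(3) by (auto intro!: derivative_eq_intros h)
  have N: "((\<lambda>z. (1 - herm z a / (1 + s)) *s a - s *s z) has_derivative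
      (\<lambda>h. - (herm h a / (1 + s)) *s a - s *s h)) (at z)"
    by (rule has_derivative_diff[OF bounded_linear.has_derivative[OF bl(1) q]
          bounded_linear.has_derivative[OF bl(2) has_derivative_ident]])
  have I: "((\<lambda>z. inverse (1 - herm z a)) has_derivative
      (\<lambda>h. inverse (1 - herm z a) * herm h a * inverse (1 - herm z a))) (at z)"
    by (rule has_derivative_eq_rhs, rule Deriv.has_derivative_inverse[where f = "\<lambda>z. 1 - herm z a",
          OF one_minus_herm_nonzero[OF z a]],
        (rule derivative_intros h)+) simp
  have "(ball_involution a has_derivative D) (at z)"
    unfolding D_def ball_involution_eq[abs_def]
    by (rule bounded_bilinear.FDERIV[OF bounded_bilinear_smult I N])
  moreover have "Vector_Spaces.linear (*s) (*s) D"
    by (rule linear_smultI)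
      (simp_all add: D_def vec_eq_iff herm_simps add_divide_distrib algebra_simps)
  ultimately show "\<exists>D. (ball_involution a has_derivative D) (at z)
      \<and> Vector_Spaces.linear (*s) (*s) D" by blast
qed (rule norm_ball_involution_less)

end

lemma Aut_ball_involution:
  assumes "norm a < 1"
  shows "ball_involution a \<in> Aut_ball"
  using holomorphic_ball_involution[OF assms refl] ball_involution_involutive[OF assms refl]
  by (auto simp: Aut_ball_def)

lemma ball_involution_center:
  assumes "norm a < 1"
  shows "ball_involution a a = 0"
proof -
  define s :: complex where "s = of_real (sqrt (1 - (norm a)\<^sup>2))"
  note p = involution_parameter[OF assms s_def]
  \<comment> \<open>At \<open>z = a\<close> the numerator is the multiple \<open>1 - |a|\<^sup>2 / (1 + s) - s\<close> of \<open>a\<close>.\<close>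
  have "1 - (1 - s\<^sup>2) / (1 + s) - s = 0"
    using p(3) by (simp add: divide_simps power2_eq_square) (simp add: algebra_simps)
  then have "(1 - (1 - s\<^sup>2) / (1 + s)) *s a - s *s a = 0"
    by (metis vector_sub_rdistrib vector_smult_lzero)
  then show ?thesis
    by (simp add: ball_involution_eq[OF assms s_def] herm_a_a[OF assms s_def])
qed

section \<open>Automorphisms that fix the origin\<close>

text \<open>The one-variable Schwarz lemma applies to the part of \<open>\<psi>\<close> in direction \<open>u\<close> along the
  disc in direction \<open>e\<close>.\<close>

lemma Schwarz_slice:
  assumes \<psi>: "holomorphic_ball_map \<psi>" and 0: "\<psi> 0 = 0" and e: "norm e \<le> 1" and u: "norm u \<le> 1"
  shows "cmod t < 1 \<Longrightarrow> cmod (herm (\<psi> (t *s e)) u) \<le> cmod t"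
    and "cmod r < 1 \<Longrightarrow> r \<noteq> 0 \<Longrightarrow> cmod (herm (\<psi> (r *s e)) u) = cmod r \<Longrightarrow>
      \<exists>\<alpha>. \<forall>t. cmod t < 1 \<longrightarrow> herm (\<psi> (t *s e)) u = \<alpha> * t"
proof -
  define F where "F t = herm (\<psi> (t *s e)) u" for t
  have te: "norm (t *s e) < 1" if "cmod t < 1" for t
    using mult_left_le[OF e norm_ge_zero, of t] that by (simp add: norm_smult)
  have "F holomorphic_on ball 0 1"
    unfolding F_def herm_def
    using holomorphic_along_line[OF \<psi> open_ball, of 0 1 0 e] te
    by (intro holomorphic_intros) auto
  moreover have "F 0 = 0" by (simp add: F_def 0 herm_simps)
  moreover have "cmod (F t) < 1" if "cmod t < 1" for t
  proof -
    have "cmod (F t) \<le> norm (\<psi> (t *s e)) * norm u" unfolding F_def by (rule cmod_herm_le)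
    also have "\<dots> \<le> norm (\<psi> (t *s e))" using u by (simp add: mult_left_le)
    also have "\<dots> < 1" using te[OF that] by (rule holomorphic_ball_mapD[OF \<psi>])
    finally show ?thesis .
  qed
  ultimately have *: "((\<forall>\<xi>. norm \<xi> < 1 \<longrightarrow> norm (F \<xi>) \<le> norm \<xi>) \<and> norm (deriv F 0) \<le> 1)
      \<and> (((\<exists>z. norm z < 1 \<and> z \<noteq> 0 \<and> norm (F z) = norm z) \<or> norm (deriv F 0) = 1)
        \<longrightarrow> (\<exists>\<alpha>. (\<forall>z. norm z < 1 \<longrightarrow> F z = \<alpha> * z) \<and> norm \<alpha> = 1))"
    by (intro Schwarz_Lemma')
  show "cmod (herm (\<psi> (t *s e)) u) \<le> cmod t" if "cmod t < 1"
    using * that unfolding F_def by blast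
  show "\<exists>\<alpha>. \<forall>t. cmod t < 1 \<longrightarrow> herm (\<psi> (t *s e)) u = \<alpha> * t"
    if "cmod r < 1" "r \<noteq> 0" "cmod (herm (\<psi> (r *s e)) u) = cmod r"
    using * that unfolding F_def by blast
qed

definition direction :: "complex^'n \<Rightarrow> complex^'n" where
  "direction w = inverse (of_real (norm w)) *s w"

lemma direction:
  shows norm_direction_le: "norm (direction w) \<le> 1"
    and smult_direction: "of_real (norm w) *s direction w = w"
    and herm_direction: "herm w (direction w) = of_real (norm w)"
  by (cases "w = 0"; simp add: direction_def norm_smult norm_inverse herm_simps herm_self
      power2_eq_square)+

lemma Schwarz_vector:
  assumes "holomorphic_ball_map \<psi>" "\<psi> 0 = 0" "norm w < 1"
  shows "norm (\<psi> w) \<le> norm w"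
  using Schwarz_slice(1)[OF assms(1,2) norm_direction_le norm_direction_le,
      of "of_real (norm w)" w "\<psi> w"] assms(3)
  by (simp add: smult_direction herm_direction)

text \<open>The equality case: the function of one variable that is tested is then the identity,
  and the equality case of Cauchy--Schwarz recovers \<open>\<psi>\<close> from it on the whole disc.\<close>

lemma Schwarz_vector_equality:
  assumes \<psi>: "holomorphic_ball_map \<psi>" and 0: "\<psi> 0 = 0" and w: "norm w < 1"
    and eq: "norm (\<psi> w) = norm w" and t: "cmod t < 1"
  shows "\<psi> (t *s direction w) = t *s direction (\<psi> w)"
proof (cases "w = 0")
  case True
  then show ?thesis by (simp add: 0 direction_def)
next
  case nz: False
  define e where "e = direction w"
  define u where "u = direction (\<psi> w)"
  have e: "norm e \<le> 1" and u: "norm u \<le> 1"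
    by (simp_all add: e_def u_def norm_direction_le)
  have Fw: "herm (\<psi> (of_real (norm w) *s e)) u = of_real (norm w)"
    by (simp add: e_def u_def smult_direction herm_direction eq)
  obtain \<alpha> where \<alpha>: "\<And>t. cmod t < 1 \<Longrightarrow> herm (\<psi> (t *s e)) u = \<alpha> * t"
    using Schwarz_slice(2)[OF \<psi> 0 e u, of "of_real (norm w)"] Fw w nz by auto
  have "\<alpha> = 1" using \<alpha>[of "of_real (norm w)"] Fw nz w by simp
  then have F: "herm (\<psi> (t *s e)) u = t" using \<alpha>[OF t] by simp
  have te: "norm (t *s e) \<le> cmod t"
    using mult_left_le[OF e norm_ge_zero, of t] by (simp add: norm_smult)
  then have "norm (\<psi> (t *s e)) \<le> cmod t"
    using Schwarz_vector[OF \<psi> 0, of "t *s e"] t by simp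
  then have 1: "(norm (\<psi> (t *s e)))\<^sup>2 \<le> (cmod t)\<^sup>2" by (rule power_mono) simp
  have "norm (t *s u) \<le> cmod t"
    using mult_left_le[OF u norm_ge_zero, of t] by (simp add: norm_smult)
  then have 2: "(norm (t *s u))\<^sup>2 \<le> (cmod t)\<^sup>2" by (rule power_mono) simp
  have "Re (herm (\<psi> (t *s e)) (t *s u)) = (cmod t)\<^sup>2"
    unfolding herm_smult_right F
    by (metis Re_complex_of_real complex_norm_square mult.commute)
  then have "(norm (\<psi> (t *s e) - t *s u))\<^sup>2 \<le> 0"
    using 1 2 unfolding norm_diff_squared by linarith
  then show ?thesis by (simp add: e_def u_def)
qed

text \<open>An automorphism that fixes \<open>0\<close> and its inverse are both contractions towards \<open>0\<close>, so
  the equality case holds everywhere.  It makes \<open>\<psi>\<close> linear on every line through \<open>0\<close>, and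
  the derivative at \<open>0\<close> is one linear map that agrees with all these restrictions.\<close>

theorem Cartan_linear:
  assumes \<psi>: "\<psi> \<in> Aut_ball" and 0: "\<psi> 0 = 0"
  obtains D where "Vector_Spaces.linear (*s) (*s) D" "\<And>w. norm w < 1 \<Longrightarrow> \<psi> w = D w"
    "\<And>w. norm (D w) = norm w"
proof -
  obtain \<delta> where hol: "holomorphic_ball_map \<psi>" "holomorphic_ball_map \<delta>"
    and inv: "\<And>z. norm z < 1 \<Longrightarrow> \<delta> (\<psi> z) = z"
    using \<psi> by (auto simp: Aut_ball_def)
  have \<delta>0: "\<delta> 0 = 0" using inv[of 0] 0 by simp
  have eq: "norm (\<psi> w) = norm w" if "norm w < 1" for w
    using Schwarz_vector[OF hol(1) 0 that] Schwarz_vector[OF hol(2) \<delta>0, of "\<psi> w"] inv[OF that] that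
    by simp
  obtain D where D: "(\<psi> has_derivative D) (at 0)" "Vector_Spaces.linear (*s) (*s) D"
    by (rule holomorphic_ball_map_derivative[OF hol(1), of 0]) auto
  have agree: "\<psi> w = D w" if w: "norm w < 1" for w
  proof -
    let ?e = "direction w" and ?u = "direction (\<psi> w)"
    note line = bounded_linear_imp_has_derivative[OF bounded_bilinear.bounded_linear_left
        [OF bounded_bilinear_smult]]
    have "((\<lambda>t. \<psi> (t *s ?e)) has_derivative (\<lambda>h. D (h *s ?e))) (at 0)"
      using diff_chain_at[OF line[of ?e "at 0"], of \<psi> D] D(1) by (simp add: o_def)
    moreover have "((\<lambda>t. \<psi> (t *s ?e)) has_derivative (\<lambda>h. h *s ?u)) (at 0)"
      by (rule has_derivative_transform_within_open[OF line open_ball[of 0 1]])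
        (simp_all add: Schwarz_vector_equality[OF hol(1) 0 w eq[OF w]])
    ultimately have "(\<lambda>h. D (h *s ?e)) = (\<lambda>h. h *s ?u)"
      by (rule has_derivative_unique)
    then have "D (of_real (norm w) *s ?e) = of_real (norm w) *s ?u"
      by metis
    then show ?thesis
      using eq[OF w] smult_direction[of w] smult_direction[of "\<psi> w"] by metis
  qed
  have "norm (D w) = norm w" for w
  proof -
    define r where "r = 1 + norm w"
    have r: "r > 0" "norm w < r" by (simp_all add: r_def add_pos_nonneg)
    define v where "v = of_real (inverse r) *s w"
    have v: "norm v < 1" using r by (simp add: v_def norm_smult norm_inverse norm_divide field_simps)
    have "norm (D v) = norm v" using agree[OF v] eq[OF v] by simp
    then show ?thesis using r by (simp add: v_def linear_smultD[OF D(2)] norm_smult norm_divide)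
  qed
  with D(2) agree show ?thesis by (rule that)
qed

section \<open>Separately polynomial functions\<close>

lemma polynomial_function_vec_const: "polynomial_function_vec (\<lambda>z. c)"
  unfolding polynomial_function_vec_def
  by (intro exI[of _ "{\<lambda>_. 0}"] exI[of _ "\<lambda>_. c"]) simp

lemma polynomial_function_vec_add:
  assumes "polynomial_function_vec p" "polynomial_function_vec q"
  shows "polynomial_function_vec (\<lambda>z. p z + q z)"
proof -
  obtain A c where p: "finite A" "\<And>z. p z = (\<Sum>\<alpha>\<in>A. c \<alpha> * (\<Prod>i\<in>UNIV. (z $ i) ^ \<alpha> i))"
    using assms(1) unfolding polynomial_function_vec_def by metis
  obtain B d where q: "finite B" "\<And>z. q z = (\<Sum>\<alpha>\<in>B. d \<alpha> * (\<Prod>i\<in>UNIV. (z $ i) ^ \<alpha> i))"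
    using assms(2) unfolding polynomial_function_vec_def by metis
  let ?c = "\<lambda>\<alpha>. (if \<alpha> \<in> A then c \<alpha> else 0) + (if \<alpha> \<in> B then d \<alpha> else 0)"
  have "p z + q z = (\<Sum>\<alpha>\<in>A \<union> B. ?c \<alpha> * (\<Prod>i\<in>UNIV. (z $ i) ^ \<alpha> i))" for z
  proof -
    have "p z = (\<Sum>\<alpha>\<in>A \<union> B. (if \<alpha> \<in> A then c \<alpha> else 0) * (\<Prod>i\<in>UNIV. (z $ i) ^ \<alpha> i))"
      unfolding p(2) using p(1) q(1) by (intro sum.mono_neutral_cong_left) auto
    moreover have "q z = (\<Sum>\<alpha>\<in>A \<union> B. (if \<alpha> \<in> B then d \<alpha> else 0) * (\<Prod>i\<in>UNIV. (z $ i) ^ \<alpha> i))"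
      unfolding q(2) using p(1) q(1) by (intro sum.mono_neutral_cong_left) auto
    ultimately show ?thesis by (simp add: sum.distrib distrib_right)
  qed
  then show ?thesis
    unfolding polynomial_function_vec_def using p(1) q(1) by (meson finite_UnI)
qed

lemma polynomial_function_vec_sum:
  assumes "finite I" "\<And>k. k \<in> I \<Longrightarrow> polynomial_function_vec (p k)"
  shows "polynomial_function_vec (\<lambda>z. \<Sum>k\<in>I. p k z)"
  using assms
  by (induction I rule: finite_induct)
    (simp_all add: polynomial_function_vec_const polynomial_function_vec_add)

lemma polynomial_function_vec_cmult:
  assumes "polynomial_function_vec p"
  shows "polynomial_function_vec (\<lambda>z. c * p z)"
proof -
  obtain A d where p: "finite A" "\<And>z. p z = (\<Sum>\<alpha>\<in>A. d \<alpha> * (\<Prod>i\<in>UNIV. (z $ i) ^ \<alpha> i))"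
    using assms unfolding polynomial_function_vec_def by metis
  then have "c * p z = (\<Sum>\<alpha>\<in>A. (c * d \<alpha>) * (\<Prod>i\<in>UNIV. (z $ i) ^ \<alpha> i))" for z
    by (simp add: sum_distrib_left mult.assoc)
  with p(1) show ?thesis unfolding polynomial_function_vec_def by metis
qed

lemma polynomial_function_vec_mult_coordinate:
  assumes "polynomial_function_vec p"
  shows "polynomial_function_vec (\<lambda>z. z $ i * p z)"
proof -
  obtain A d where p: "finite A" "\<And>z. p z = (\<Sum>\<alpha>\<in>A. d \<alpha> * (\<Prod>i\<in>UNIV. (z $ i) ^ \<alpha> i))"
    using assms unfolding polynomial_function_vec_def by metis
  let ?up = "\<lambda>\<alpha> :: 'a \<Rightarrow> nat. \<alpha>(i := Suc (\<alpha> i))"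
  let ?down = "\<lambda>\<alpha> :: 'a \<Rightarrow> nat. \<alpha>(i := \<alpha> i - 1)"
  have down: "?down (?up \<alpha>) = \<alpha>" for \<alpha> by auto
  have inj: "inj_on ?up A" by (rule inj_on_inverseI[of _ ?down]) (rule down)
  have "(\<Prod>j\<in>UNIV. (z $ j) ^ ?up \<alpha> j) = z $ i * (\<Prod>j\<in>UNIV. (z $ j) ^ \<alpha> j)"
    for z :: "complex^'a" and \<alpha>
    by (simp add: prod.remove[of UNIV i] mult.assoc)
  then have eq: "z $ i * p z = (\<Sum>\<alpha>\<in>?up ` A. d (?down \<alpha>) * (\<Prod>i\<in>UNIV. (z $ i) ^ \<alpha> i))" for z
    unfolding sum.reindex[OF inj] o_def down p(2)
    by (simp add: sum_distrib_left mult_ac del: fun_upd_apply)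
  show ?thesis
    unfolding polynomial_function_vec_def
    by (intro exI[of _ "?up ` A"] exI[of _ "\<lambda>\<alpha>. d (?down \<alpha>)"] conjI allI finite_imageI p(1) eq)
qed

lemma polynomial_function_vec_power_coordinate:
  assumes "polynomial_function_vec p"
  shows "polynomial_function_vec (\<lambda>z. (z $ i) ^ k * p z)"
proof (induction k)
  case (Suc k)
  show ?case using polynomial_function_vec_mult_coordinate[OF Suc, of i] by (simp add: mult.assoc)
qed (use assms in simp)

text \<open>Averaging over the roots of unity is a finite Fourier inversion: a coefficient of a
  polynomial is a linear combination, with fixed weights, of finitely many of its values.\<close>

lemma coefficient_by_roots_of_unity:
  fixes c :: "nat \<Rightarrow> complex"
  assumes p: "\<And>j. p (cis (2 * pi / Suc d) ^ j) = (\<Sum>k\<le>d. c k * (cis (2 * pi / Suc d) ^ j) ^ k)"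
    and k: "k \<le> d"
  shows "c k = (\<Sum>j\<le>d. inverse (Suc d) * inverse (cis (2 * pi / Suc d) ^ (j * k))
      * p (cis (2 * pi / Suc d) ^ j))"
proof -
  define \<zeta> where "\<zeta> = cis (2 * pi / Suc d)"
  have \<zeta>0: "\<zeta> \<noteq> 0" by (simp add: \<zeta>_def)
  have pow: "\<zeta> ^ Suc d = 1"
    unfolding \<zeta>_def Complex.DeMoivre by simp
  have orth: "(\<Sum>j\<le>d. (\<zeta> ^ l / \<zeta> ^ k) ^ j) = (if l = k then of_nat (Suc d) else 0)" if l: "l \<le> d" for l
  proof (cases "l = k")
    case True
    then show ?thesis using \<zeta>0 by simp
  next
    case False
    have "\<zeta> ^ l \<noteq> \<zeta> ^ k"
    proof
      assume "\<zeta> ^ l = \<zeta> ^ k"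
      moreover have "l < Suc d" "k < Suc d" using l k by auto
      ultimately have "l = k"
        using inj_onD[OF bij_betw_imp_inj_on[OF Complex.bij_betw_roots_unity[of "Suc d"]], of l k]
        by (simp add: \<zeta>_def Complex.DeMoivre mult_ac)
      with False show False by simp
    qed
    then have ne: "\<zeta> ^ l / \<zeta> ^ k \<noteq> 1" using \<zeta>0 by simp
    have one: "(\<zeta> ^ l / \<zeta> ^ k) ^ Suc d = 1"
      by (simp only: power_divide power_mult[symmetric] mult.commute[of _ "Suc d"])
        (simp only: power_mult pow, simp)
    have "(\<Sum>j\<le>d. (\<zeta> ^ l / \<zeta> ^ k) ^ j) = 0"
      using geometric_sum[OF ne, of "Suc d"] unfolding one lessThan_Suc_atMost by simp
    then show ?thesis using False by simp
  qed
  have "(\<Sum>j\<le>d. inverse (Suc d) * inverse (\<zeta> ^ (j * k)) * p (\<zeta> ^ j))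
      = (\<Sum>j\<le>d. \<Sum>l\<le>d. inverse (Suc d) * c l * (\<zeta> ^ l / \<zeta> ^ k) ^ j)"
    by (intro sum.cong refl)
      (simp add: p[folded \<zeta>_def] sum_distrib_left divide_inverse power_mult_distrib power_inverse
        power_mult[symmetric] mult_ac)
  also have "\<dots> = (\<Sum>l\<le>d. inverse (Suc d) * c l * (\<Sum>j\<le>d. (\<zeta> ^ l / \<zeta> ^ k) ^ j))"
    by (subst sum.swap) (simp add: sum_distrib_left)
  also have "\<dots> = (\<Sum>l\<le>d. if l = k then c k else 0)"
    by (intro sum.cong refl) (simp add: orth del: of_nat_Suc)
  also have "\<dots> = c k" using k by simp
  finally show ?thesis by (simp add: \<zeta>_def)
qed

text \<open>The coordinates are released one at a time.  When the coordinate \<open>i\<close> is added, the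
  coefficients of its powers are combinations of values of \<open>F\<close> on translates, and translates
  of \<open>F\<close> are separately polynomial as well.\<close>

lemma separately_polynomial_on_coordinate_subspace:
  fixes F :: "complex^'n \<Rightarrow> complex"
  assumes "finite S"
    and "\<And>z i. \<exists>c. \<forall>t. F (z + t *s axis i 1) = (\<Sum>k\<le>d. c k * t ^ k)"
  shows "polynomial_function_vec (\<lambda>z. F (\<chi> i. if i \<in> S then z $ i else 0))"
  using assms
proof (induction S arbitrary: F rule: finite_induct)
  case empty
  then show ?case by (simp add: polynomial_function_vec_const)
next
  case (insert i S)
  define res where "res z = (\<chi> j. if j \<in> S then z $ j else 0)" for z :: "complex^'n"
  define \<zeta> where "\<zeta> = cis (2 * pi / Suc d)"
  define m where "m j k = inverse (of_nat (Suc d)) * inverse (\<zeta> ^ (j * k))" for j k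
  have split: "(\<chi> j. if j \<in> insert i S then z $ j else 0) = res z + z $ i *s axis i 1" for z :: "complex^'n"
    using insert.hyps by (auto simp: vec_eq_iff res_def axis_def)
  have expand: "F (res z + z $ i *s axis i 1)
      = (\<Sum>k\<le>d. (z $ i) ^ k * (\<Sum>j\<le>d. m j k * F (res z + \<zeta> ^ j *s axis i 1)))" for z
  proof -
    obtain c where c: "\<And>t. F (res z + t *s axis i 1) = (\<Sum>k\<le>d. c k * t ^ k)"
      using insert.prems by metis
    have "c k = (\<Sum>j\<le>d. m j k * F (res z + \<zeta> ^ j *s axis i 1))" if "k \<le> d" for k
      using coefficient_by_roots_of_unity[where p = "\<lambda>t. F (res z + t *s axis i 1)", OF c that]
      by (simp add: m_def \<zeta>_def)
    then show ?thesis by (simp add: c mult.commute)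
  qed
  have "polynomial_function_vec (\<lambda>z. F (res z + \<zeta> ^ j *s axis i 1))" for j
    unfolding res_def
  proof (rule insert.IH)
    fix z :: "complex^'n" and l
    show "\<exists>c. \<forall>t. F (z + t *s axis l 1 + \<zeta> ^ j *s axis i 1) = (\<Sum>k\<le>d. c k * t ^ k)"
      using insert.prems[of "z + \<zeta> ^ j *s axis i 1" l] by (simp add: add_ac)
  qed
  then show ?case
    unfolding split expand
    by (intro polynomial_function_vec_sum polynomial_function_vec_power_coordinate
        polynomial_function_vec_cmult finite_atMost)
qed

lemma separately_polynomial:
  fixes F :: "complex^'n \<Rightarrow> complex"
  assumes "\<And>z i. \<exists>c. \<forall>t. F (z + t *s axis i 1) = (\<Sum>k\<le>d. c k * t ^ k)"
  shows "polynomial_function_vec F"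
  using separately_polynomial_on_coordinate_subspace[of UNIV F d, OF _ assms] by simp

section \<open>Homogeneous holomorphic functions are polynomials\<close>

text \<open>By homogeneity \<open>a\<close> extends from the ball to the whole space, and the extension grows at
  most like \<open>|z|\<^sup>k\<close>.  Liouville's theorem makes it a polynomial of degree at most \<open>k\<close> along
  every line in a coordinate direction.\<close>

lemma homogeneous_holomorphic_polynomial:
  fixes a :: "complex^'n \<Rightarrow> complex"
  assumes hom: "\<And>t z. norm z < 1 \<Longrightarrow> cmod t \<le> 1 \<Longrightarrow> a (t *s z) = t ^ k * a z"
    and bound: "\<And>z. norm z < 1 \<Longrightarrow> cmod (a z) \<le> 1"
    and hol: "\<And>T z w. open T \<Longrightarrow> (\<And>t. t \<in> T \<Longrightarrow> norm (z + t *s w) < 1) \<Longrightarrow>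
      (\<lambda>t. a (z + t *s w)) holomorphic_on T"
  shows "\<exists>p. polynomial_function_vec p \<and> (\<forall>z. norm z < 1 \<longrightarrow> p z = a z)"
proof -
  \<comment> \<open>The value of the extension at \<open>z\<close> may be computed with any radius \<open>R > |z|\<close>.\<close>
  define ext where "ext R z = of_real R ^ k * a (of_real (inverse R) *s z)" for R z
  have mono: "ext R' z = ext R z" if R: "norm z < R" "R \<le> R'" for R R' z
  proof -
    have pos: "R > 0" "R' > 0" using R norm_ge_zero[of z] by linarith+
    have "norm (of_real (inverse R) *s z) < 1"
      using pos R by (simp add: norm_smult norm_inverse norm_divide field_simps)
    moreover have "cmod (of_real (R / R')) \<le> 1" using pos R by (simp add: norm_divide)
    ultimately have "a (of_real (R / R') *s (of_real (inverse R) *s z))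
        = of_real (R / R') ^ k * a (of_real (inverse R) *s z)"
      by (rule hom)
    moreover have "of_real (R / R') *s (of_real (inverse R) *s z) = of_real (inverse R') *s z"
    proof -
      have "R / R' * inverse R = inverse R'" using pos by (simp add: field_simps)
      then show ?thesis by (metis of_real_mult vector_smult_assoc)
    qed
    ultimately have "ext R' z = (of_real R' * of_real (R / R')) ^ k * a (of_real (inverse R) *s z)"
      by (simp only: ext_def power_mult_distrib mult.assoc)
    also have "of_real R' * of_real (R / R') = (of_real R :: complex)" using pos by simp
    finally show ?thesis by (simp only: ext_def)
  qed
  define H where "H z = ext (1 + norm z) z" for z
  have H: "H z = ext R z" if "norm z < R" for R z
  proof (cases "R \<le> 1 + norm z")
    case True
    then show ?thesis using mono[OF that True] by (simp add: H_def)
  next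
    case False
    then show ?thesis using mono[of z "1 + norm z" R] by (simp add: H_def)
  qed
  have growth: "cmod (H z) \<le> (1 + norm z) ^ k" for z
  proof -
    have pos: "1 + norm z > 0" by (simp add: add_pos_nonneg)
    have "norm (of_real (inverse (1 + norm z)) *s z) < 1"
      using pos by (simp only: norm_smult norm_of_real) (simp add: field_simps)
    then have "cmod (a (of_real (inverse (1 + norm z)) *s z)) \<le> 1" by (rule bound)
    then have "(1 + norm z) ^ k * cmod (a (of_real (inverse (1 + norm z)) *s z)) \<le> (1 + norm z) ^ k"
      using pos by (intro mult_left_le) auto
    moreover have "cmod (of_real (1 + norm z)) = 1 + norm z"
      using pos by (simp only: norm_of_real)
    ultimately show ?thesis by (simp only: H_def ext_def norm_mult norm_power)
  qed
  have entire: "(\<lambda>t. H (z + t *s axis i 1)) holomorphic_on UNIV" for z i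
  proof -
    have ax: "norm (axis i 1 :: complex^'n) = 1" by (simp add: norm_axis_1)
    have "(\<lambda>t. H (z + t *s axis i 1)) field_differentiable at u" for u
    proof -
      \<comment> \<open>One radius that serves the whole disc of radius \<open>1\<close> around \<open>u\<close>.\<close>
      define R where "R = 2 + norm z + cmod u"
      have R: "R > 0" by (simp add: R_def add_pos_nonneg)
      have lt: "norm (z + t *s axis i 1) < R" if "t \<in> ball u 1" for t
      proof -
        have "cmod t < 1 + cmod u"
          using that norm_triangle_ineq2[of t u] by (simp add: dist_norm norm_minus_commute)
        then show ?thesis
          using norm_triangle_ineq[of z "t *s axis i 1"] by (simp add: norm_smult ax R_def)
      qed
      let ?c = "of_real (inverse R) :: complex"
      have shift: "?c *s z + t *s (?c *s axis i 1) = ?c *s (z + t *s axis i 1)" for t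
        by (simp add: vec_eq_iff algebra_simps)
      have "norm (?c *s z + t *s (?c *s axis i 1)) < 1" if "t \<in> ball u 1" for t
        unfolding shift using lt[OF that] R
        by (simp only: norm_smult norm_of_real) (simp add: field_simps)
      then have "(\<lambda>t. a (?c *s z + t *s (?c *s axis i 1))) holomorphic_on ball u 1"
        by (rule hol[OF open_ball])
      then have "(\<lambda>t. of_real R ^ k * a (?c *s (z + t *s axis i 1))) holomorphic_on ball u 1"
        unfolding shift by (intro holomorphic_intros)
      then have "(\<lambda>t. H (z + t *s axis i 1)) holomorphic_on ball u 1"
        by (rule holomorphic_transform) (simp only: H[OF lt] ext_def)
      then show ?thesis
        by (rule holomorphic_on_imp_differentiable_at) simp_all
    qed
    then show ?thesis
      by (simp add: holomorphic_on_def)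
  qed
  have "\<exists>c. \<forall>t. H (z + t *s axis i 1) = (\<Sum>l\<le>k. c l * t ^ l)" for z i
  proof -
    have bd: "cmod (H (z + t *s axis i 1)) \<le> (2 + norm z) ^ k * cmod t ^ k" if t: "1 \<le> cmod t" for t
    proof -
      have "1 + norm (z + t *s axis i 1) \<le> 1 + norm z + cmod t"
        using norm_triangle_ineq[of z "t *s axis i 1"] by (simp add: norm_smult norm_axis_1)
      also have "\<dots> \<le> (2 + norm z) * cmod t"
        using mult_left_mono[OF t, of "1 + norm z"] by (simp add: algebra_simps)
      finally have "(1 + norm (z + t *s axis i 1)) ^ k \<le> ((2 + norm z) * cmod t) ^ k"
        by (rule power_mono) (simp add: add_nonneg_nonneg)
      then show ?thesis
        using growth[of "z + t *s axis i 1"] by (simp add: power_mult_distrib)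
    qed
    have "H (z + t *s axis i 1)
        = (\<Sum>l\<le>k. (deriv ^^ l) (\<lambda>t. H (z + t *s axis i 1)) 0 / fact l * t ^ l)" for t
      by (rule Liouville_polynomial[OF entire, where A = 1]) (rule bd)
    then show ?thesis by (intro exI allI)
  qed
  then have "polynomial_function_vec H" by (rule separately_polynomial)
  moreover have "H z = a z" if "norm z < 1" for z
    using H[OF that] by (simp add: ext_def)
  ultimately show ?thesis by blast
qed

section \<open>Expansion into homogeneous components\<close>

text \<open>The homogeneous component of degree \<open>k\<close> of \<open>g\<close>, evaluated at \<open>z\<close>, is the Taylor
  coefficient of order \<open>k\<close> of \<open>g\<close> along the disc through \<open>z\<close>.\<close>

definition hom_component :: "(complex^'n \<Rightarrow> complex^'m) \<Rightarrow> nat \<Rightarrow> complex^'n \<Rightarrow> complex^'m" where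
  "hom_component g k z = (\<chi> j. (deriv ^^ k) (\<lambda>t. g (t *s z) $ j) 0 / fact k)"

lemma smult_in_ball:
  fixes z :: "complex^'n"
  assumes "norm z < 1" "cmod t \<le> 1"
  shows "norm (t *s z) < 1"
  using assms mult_right_mono[OF assms(2) norm_ge_zero, of z] by (simp add: norm_smult)

lemma holomorphic_through_origin:
  assumes "holomorphic_ball_map g" "open T" "\<And>t. t \<in> T \<Longrightarrow> norm (t *s z) < 1"
  shows "(\<lambda>t. g (t *s z) $ j) holomorphic_on T"
  using holomorphic_along_line[OF assms(1,2), of 0 z j] assms(3) by simp

text \<open>The radius exceeds \<open>1\<close>, so that the expansion is valid at \<open>z\<close> itself.\<close>

lemma smult_in_ball_of_larger_disc:
  fixes z :: "complex^'n"
  assumes "norm z < 1" "t \<in> ball 0 (2 / (1 + norm z))"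
  shows "norm (t *s z) < 1"
proof -
  have "1 + norm z > 0" by (simp add: add_pos_nonneg)
  then have "cmod t * (1 + norm z) < 2" using assms(2) by (simp add: pos_less_divide_eq)
  moreover have "cmod t * norm z \<le> cmod t * ((1 + norm z) / 2)"
    using assms(1) by (intro mult_left_mono) auto
  ultimately show ?thesis by (simp add: norm_smult)
qed

lemma hom_component_sums:
  assumes g: "holomorphic_ball_map g" and z: "norm z < 1" and t: "cmod t \<le> 1"
  shows "(\<lambda>k. hom_component g k z $ j * t ^ k) sums (g (t *s z) $ j)"
proof -
  have "1 < 2 / (1 + norm z)"
    using z by (simp add: pos_less_divide_eq add_pos_nonneg)
  then have "t \<in> ball 0 (2 / (1 + norm z))" using t by simp
  from holomorphic_power_series[OF holomorphic_through_origin[OF g open_ball] this, of z j]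
  show ?thesis using smult_in_ball_of_larger_disc[OF z] by (simp add: hom_component_def)
qed

lemma hom_component_smult:
  assumes g: "holomorphic_ball_map g" and z: "norm z < 1" and u: "cmod u \<le> 1"
  shows "hom_component g k (u *s z) = u ^ k *s hom_component g k z"
proof -
  have lt: "norm (t *s z) < 1" if "t \<in> ball 0 1" for t
    using that z by (intro smult_in_ball) auto
  have "(deriv ^^ k) (\<lambda>t. g ((u * t) *s z) $ j) 0 = u ^ k * (deriv ^^ k) (\<lambda>t. g (t *s z) $ j) (u * 0)" for j
  proof (rule higher_deriv_compose_linear[OF holomorphic_through_origin[OF g open_ball lt]
        open_ball[of 0 1] open_ball])
    show "u * t \<in> ball 0 1" if "t \<in> ball 0 1" for t
      using that mult_right_mono[OF u norm_ge_zero, of t] by (simp add: norm_mult)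
  qed simp_all
  then show ?thesis
    by (simp add: hom_component_def vec_eq_iff vector_smult_assoc mult.commute)
qed

lemma higher_deriv_linear_combination:
  assumes "finite I" "\<And>i. i \<in> I \<Longrightarrow> f i holomorphic_on S" "open S" "x \<in> S"
  shows "(deriv ^^ k) (\<lambda>x. \<Sum>i\<in>I. c i * f i x) x = (\<Sum>i\<in>I. c i * (deriv ^^ k) (f i) x)"
  using assms(1,2)
proof (induction I rule: finite_induct)
  case empty
  show ?case using higher_deriv_cmult[of "\<lambda>x. x" UNIV x k 0] by simp
next
  case (insert i I)
  have f: "f i holomorphic_on S" "\<And>j. j \<in> I \<Longrightarrow> f j holomorphic_on S"
    using insert.prems by auto
  have "(deriv ^^ k) (\<lambda>x. c i * f i x + (\<Sum>i\<in>I. c i * f i x)) x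
      = (deriv ^^ k) (\<lambda>x. c i * f i x) x + (deriv ^^ k) (\<lambda>x. \<Sum>i\<in>I. c i * f i x) x"
    by (rule higher_deriv_add[of _ S]) (intro holomorphic_intros f assms(3,4); assumption)+
  then show ?case
    using insert.hyps insert.IH[OF f(2)] higher_deriv_cmult[OF f(1) assms(4,3)] by simp
qed

text \<open>A linear relation between \<open>g\<close> and a rotation of \<open>g\<close> passes to the components, which the
  rotation only multiplies by a scalar: they are eigenvectors.\<close>

lemma hom_component_eigenvector:
  assumes g: "holomorphic_ball_map g" and D: "Vector_Spaces.linear (*s) (*s) D"
    and u: "cmod u \<le> 1" and rel: "\<And>z. norm z < 1 \<Longrightarrow> g (u *s z) = D (g z)"
    and z: "norm z < 1"
  shows "D (hom_component g k z) = u ^ k *s hom_component g k z"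
proof -
  define M where "M = matrix D"
  have M: "D v $ i = (\<Sum>j\<in>UNIV. M $ i $ j * v $ j)" for v i
    unfolding M_def by (subst matrix_works[OF D, symmetric]) (simp add: matrix_vector_mult_def)
  have "hom_component g k (u *s z) $ i = D (hom_component g k z) $ i" for i
  proof -
    have "(deriv ^^ k) (\<lambda>t. g (t *s (u *s z)) $ i) 0
        = (deriv ^^ k) (\<lambda>t. \<Sum>j\<in>UNIV. M $ i $ j * g (t *s z) $ j) 0"
    proof (rule higher_deriv_transform_within_open[OF _ _ open_ball[of 0 1]])
      show "(\<lambda>t. g (t *s (u *s z)) $ i) holomorphic_on ball 0 1"
        by (rule holomorphic_through_origin[OF g open_ball], rule smult_in_ball)
          (simp_all add: smult_in_ball[OF z u])
      show "(\<lambda>t. \<Sum>j\<in>UNIV. M $ i $ j * g (t *s z) $ j) holomorphic_on ball 0 1"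
        using z by (intro holomorphic_intros holomorphic_through_origin[OF g])
          (simp_all add: smult_in_ball)
      show "g (t *s (u *s z)) $ i = (\<Sum>j\<in>UNIV. M $ i $ j * g (t *s z) $ j)" if "t \<in> ball 0 1" for t
        using rel[of "t *s z"] that z
        by (simp add: M[symmetric] smult_in_ball vector_smult_assoc mult.commute)
    qed simp
    also have "\<dots> = (\<Sum>j\<in>UNIV. M $ i $ j * (deriv ^^ k) (\<lambda>t. g (t *s z) $ j) 0)"
      using z by (intro higher_deriv_linear_combination[of _ _ "ball 0 1"]
          holomorphic_through_origin[OF g]) (simp_all add: smult_in_ball)
    finally show ?thesis
      by (simp add: hom_component_def M sum_divide_distrib)
  qed
  then show ?thesis
    by (simp add: vec_eq_iff hom_component_smult[OF g z u])
qed

text \<open>That \<open>D\<close> preserves the norm of \<open>x + t y\<close> for every complex \<open>t\<close> forces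
  \<open>\<langle>x, y\<rangle> = \<mu> cnj \<nu> \<langle>x, y\<rangle>\<close>, and \<open>\<mu> cnj \<nu> \<noteq> 1\<close> for different eigenvalues of modulus \<open>1\<close>.\<close>

lemma isometry_eigenvectors_orthogonal:
  assumes D: "Vector_Spaces.linear (*s) (*s) D" and iso: "\<And>v. norm (D v) = norm v"
    and x: "D x = \<mu> *s x" and y: "D y = \<nu> *s y"
    and unit: "cmod \<mu> = 1" "cmod \<nu> = 1" and ne: "\<mu> \<noteq> \<nu>"
  shows "herm x y = 0"
proof -
  \<comment> \<open>With \<open>t = q\<close>, the equality of the two norms reads \<open>|q|\<^sup>2 = 0\<close>.\<close>
  define q where "q = (1 - \<mu> * cnj \<nu>) * herm x y"
  have "D (x + q *s y) = \<mu> *s x + (q * \<nu>) *s y"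
    by (simp add: linear_smultD[OF D] x y vector_smult_assoc)
  then have "(norm (\<mu> *s x + (q * \<nu>) *s y))\<^sup>2 = (norm (x + q *s y))\<^sup>2"
    using iso by metis
  then have "Re (herm x (q *s y)) = Re (herm (\<mu> *s x) ((q * \<nu>) *s y))"
    by (simp add: norm_add_squared norm_smult norm_mult unit)
  then have "Re (cnj q * herm x y - \<mu> * (cnj q * cnj \<nu>) * herm x y) = 0"
    by (simp only: herm_smult_left herm_smult_right complex_cnj_mult minus_complex.simps mult_ac
        diff_self)
  moreover have "cnj q * herm x y - \<mu> * (cnj q * cnj \<nu>) * herm x y = of_real ((cmod q)\<^sup>2)"
    by (simp only: complex_norm_square) (simp add: q_def algebra_simps)
  ultimately have "q = 0" by simp
  moreover have "1 - \<mu> * cnj \<nu> \<noteq> 0"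
  proof
    assume "1 - \<mu> * cnj \<nu> = 0"
    then have "\<nu> = \<mu> * (\<nu> * cnj \<nu>)" by (simp add: mult_ac)
    also have "\<nu> * cnj \<nu> = 1" using complex_norm_square[of \<nu>] unit by simp
    finally show False using ne by simp
  qed
  ultimately show ?thesis by (simp add: q_def)
qed

text \<open>A rotation by \<open>\<pi> / (l - k)\<close> has different eigenvalues in degrees \<open>k\<close> and \<open>l\<close>.  Hence
  values of components of different degrees are orthogonal, and only finitely many degrees
  can occur in a space of finite dimension.\<close>

lemma finitely_many_hom_components:
  fixes g :: "complex^'n \<Rightarrow> complex^'m"
  assumes g: "holomorphic_ball_map g"
    and rot: "\<And>\<theta>. \<exists>D. Vector_Spaces.linear (*s) (*s) D \<and> (\<forall>v. norm (D v) = norm v)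
      \<and> (\<forall>z. norm z < 1 \<longrightarrow> g (cis \<theta> *s z) = D (g z))"
  shows "finite {k. \<exists>z. norm z < 1 \<and> hom_component g k z \<noteq> 0}"
proof -
  let ?K = "{k. \<exists>z. norm z < 1 \<and> hom_component g k z \<noteq> 0}"
  have orth: "inner (hom_component g k z) (hom_component g l w) = 0"
    if "k < l" "norm z < 1" "norm w < 1" for k l z w
  proof -
    define \<theta> where "\<theta> = pi / real (l - k)"
    obtain D where D: "Vector_Spaces.linear (*s) (*s) D" "\<And>v. norm (D v) = norm v"
      "\<And>z. norm z < 1 \<Longrightarrow> g (cis \<theta> *s z) = D (g z)"
      using rot by metis
    have "cis \<theta> ^ l = cis \<theta> ^ k * cis \<theta> ^ (l - k)"
      using that(1) by (simp flip: power_add)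
    also have "cis \<theta> ^ (l - k) = -1"
      using that(1) by (simp add: Complex.DeMoivre \<theta>_def)
    finally have "cis \<theta> ^ k \<noteq> cis \<theta> ^ l"
      by (simp add: equation_minus_iff)
    moreover have "D (hom_component g n x) = cis \<theta> ^ n *s hom_component g n x"
      if "norm x < 1" for n x
      by (rule hom_component_eigenvector[OF g D(1)]) (use that D(3) in auto)
    ultimately have "herm (hom_component g k z) (hom_component g l w) = 0"
      using that by (intro isometry_eigenvectors_orthogonal[OF D(1,2)]) (auto simp: norm_power)
    then show ?thesis by (simp add: inner_eq_Re_herm)
  qed
  have "\<forall>k\<in>?K. \<exists>z. norm z < 1 \<and> hom_component g k z \<noteq> 0" by blast
  from bchoice[OF this] obtain z
    where z: "\<And>k. k \<in> ?K \<Longrightarrow> norm (z k) < 1 \<and> hom_component g k (z k) \<noteq> 0" by blast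
  define v where "v k = hom_component g k (z k)" for k
  have v: "inner (v k) (v l) = 0" if "k \<in> ?K" "l \<in> ?K" "k \<noteq> l" for k l
  proof (cases "k < l")
    case True
    then show ?thesis
      using orth z[OF that(1)] z[OF that(2)] by (simp add: v_def)
  next
    case False
    then have "l < k" using that(3) by simp
    then show ?thesis
      unfolding inner_commute[of "v k"] using orth z[OF that(1)] z[OF that(2)] by (simp add: v_def)
  qed
  have "pairwise orthogonal (v ` ?K)"
    unfolding pairwise_def orthogonal_def using v by blast
  then have "finite (v ` ?K)" by (rule pairwise_orthogonal_imp_finite)
  moreover have "inj_on v ?K"
  proof (rule inj_onI, rule ccontr)
    fix k l assume K: "k \<in> ?K" "l \<in> ?K" and eq: "v k = v l" and ne: "k \<noteq> l"
    have "v k = 0" using v[OF K ne] unfolding eq[symmetric] by simp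
    then show False using z[OF K(1)] by (simp only: v_def simp_thms)
  qed
  ultimately show ?thesis by (rule finite_imageD)
qed

text \<open>With finitely many components, each of them is an average of rotations of \<open>g\<close>, and
  inherits holomorphy and a bound from \<open>g\<close>.\<close>

lemma finite_expansion_polynomial:
  fixes g :: "complex^'n \<Rightarrow> complex^'m"
  assumes g: "holomorphic_ball_map g"
    and fin: "finite {k. \<exists>z. norm z < 1 \<and> hom_component g k z \<noteq> 0}"
  obtains G :: "complex^'n \<Rightarrow> complex^'m"
  where "polynomial_map G" "\<And>z. norm z < 1 \<Longrightarrow> G z = g z"
proof -
  obtain d where d: "\<And>k z. norm z < 1 \<Longrightarrow> d < k \<Longrightarrow> hom_component g k z = 0"
    using finite_nat_set_iff_bounded_le[THEN iffD1, OF fin] by (auto simp: not_less[symmetric])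
  have expand: "g (t *s z) $ j = (\<Sum>k\<le>d. hom_component g k z $ j * t ^ k)"
    if z: "norm z < 1" and t: "cmod t \<le> 1" for z t j
  proof -
    have "(\<lambda>k. hom_component g k z $ j * t ^ k) sums (\<Sum>k\<le>d. hom_component g k z $ j * t ^ k)"
      by (rule sums_finite) (auto simp: d[OF z])
    with hom_component_sums[OF g z t] show ?thesis by (rule sums_unique2)
  qed
  define \<zeta> where "\<zeta> = cis (2 * pi / Suc d)"
  have norm_\<zeta>: "cmod \<zeta> = 1" by (simp add: \<zeta>_def)
  define m where "m k l = inverse (complex_of_nat (Suc d)) * inverse (\<zeta> ^ (l * k))" for k l
  have norm_m: "cmod (m k l) = inverse (real (Suc d))" for k l
    by (simp only: m_def norm_mult norm_inverse norm_power norm_\<zeta> norm_of_nat) simp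
  have average: "hom_component g k z $ j = (\<Sum>l\<le>d. m k l * g (\<zeta> ^ l *s z) $ j)"
    if z: "norm z < 1" and k: "k \<le> d" for z k j
    using coefficient_by_roots_of_unity[where p = "\<lambda>t. g (t *s z) $ j", OF _ k]
      expand[OF z] by (simp add: m_def \<zeta>_def norm_power)
  have "\<exists>p. polynomial_function_vec p \<and> (\<forall>z. norm z < 1 \<longrightarrow> p z = hom_component g k z $ j)"
    if k: "k \<le> d" for k j
  proof (rule homogeneous_holomorphic_polynomial)
    show "hom_component g k (t *s z) $ j = t ^ k * hom_component g k z $ j"
      if "norm z < 1" "cmod t \<le> 1" for t z
      by (simp add: hom_component_smult[OF g that])
    have rot: "norm (\<zeta> ^ l *s z) < 1" if "norm z < 1" for l and z :: "complex^'n"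
      using that by (simp add: norm_smult norm_power norm_\<zeta>)
    show "cmod (hom_component g k z $ j) \<le> 1" if z: "norm z < 1" for z
    proof -
      have "cmod (m k l * g (\<zeta> ^ l *s z) $ j) \<le> inverse (real (Suc d))" for l
      proof -
        have "cmod (g (\<zeta> ^ l *s z) $ j) \<le> 1"
          using Finite_Cartesian_Product.norm_nth_le[of "g (\<zeta> ^ l *s z)" j]
            holomorphic_ball_mapD[OF g rot[OF z, of l]] by linarith
        then show ?thesis unfolding norm_mult norm_m by (intro mult_left_le) auto
      qed
      then have "cmod (hom_component g k z $ j) \<le> (\<Sum>l\<le>d. inverse (real (Suc d)))"
        unfolding average[OF z k] by (intro sum_norm_le) auto
      also have "\<dots> = 1" by simp
      finally show ?thesis .
    qed
    show "(\<lambda>t. hom_component g k (z + t *s w) $ j) holomorphic_on T"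
      if T: "open T" and sub: "\<And>t. t \<in> T \<Longrightarrow> norm (z + t *s w) < 1" for T z w
    proof -
      have shift: "\<zeta> ^ l *s (z + t *s w) = \<zeta> ^ l *s z + t *s (\<zeta> ^ l *s w)" for l t
        by (simp add: vec_eq_iff algebra_simps)
      have "(\<lambda>t. g (\<zeta> ^ l *s z + t *s (\<zeta> ^ l *s w)) $ j) holomorphic_on T" for l
        by (rule holomorphic_along_line[OF g T]) (use rot[OF sub] in \<open>simp only: shift[symmetric]\<close>)
      then have "(\<lambda>t. \<Sum>l\<le>d. m k l * g (\<zeta> ^ l *s (z + t *s w)) $ j) holomorphic_on T"
        unfolding shift by (intro holomorphic_intros)
      then show ?thesis
        by (rule holomorphic_transform) (simp add: average[OF sub k])
    qed
  qed
  then obtain p where p: "\<And>k j. k \<le> d \<Longrightarrow> polynomial_function_vec (p k j)"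
    "\<And>k j z. k \<le> d \<Longrightarrow> norm z < 1 \<Longrightarrow> p k j z = hom_component g k z $ j"
    by metis
  show ?thesis
  proof
    show "polynomial_map (\<lambda>z. \<chi> j. \<Sum>k\<le>d. p k j z)"
      unfolding polynomial_map_def vec_lambda_beta
      by (intro allI polynomial_function_vec_sum p(1)) auto
    show "(\<chi> j. \<Sum>k\<le>d. p k j z) = g z" if z: "norm z < 1" for z
      using expand[OF z, of 1] by (simp add: vec_eq_iff p(2)[OF _ z])
  qed
qed

section \<open>Maps whose symmetries contain the circle\<close>

text \<open>The rotations fix \<open>0\<close>, so the matching automorphisms of the target fix \<open>f 0\<close>.  After
  \<open>f 0\<close> has been moved to the origin they are unitary.\<close>

lemma rotations_become_linear:
  fixes f :: "complex^'n \<Rightarrow> complex^'m"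
  assumes f: "holomorphic_ball_map f"
    and sym: "(*v) ` (unitary_center :: (complex^'n^'n) set) \<subseteq> Gamma_group f"
  shows "\<exists>D. Vector_Spaces.linear (*s) (*s) D \<and> (\<forall>v. norm (D v) = norm v)
      \<and> (\<forall>z. norm z < 1 \<longrightarrow>
        (ball_involution (f 0) \<circ> f) (cis \<theta> *s z) = D ((ball_involution (f 0) \<circ> f) z))"
proof -
  let ?\<phi> = "ball_involution (f 0)"
  have f0: "norm (f 0) < 1" using holomorphic_ball_mapD[OF f, of 0] by simp
  have inv: "?\<phi> (?\<phi> w) = w" if "norm w < 1" for w
    by (rule ball_involution_involutive[OF f0 refl that])
  have "(\<lambda>z. cis \<theta> *s z) \<in> Gamma_group f"
    using sym unfolding unitary_center_maps by blast
  then obtain \<psi> where \<psi>: "\<psi> \<in> Aut_ball" "\<And>z. norm z < 1 \<Longrightarrow> f (cis \<theta> *s z) = \<psi> (f z)"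
    by (auto simp: Gamma_group_def A_group_def)
  define \<omega> where "\<omega> = ?\<phi> \<circ> \<psi> \<circ> ?\<phi>"
  have "\<omega> \<in> Aut_ball"
    unfolding \<omega>_def by (intro Aut_ball_compose Aut_ball_involution f0 \<psi>(1))
  moreover have "\<omega> 0 = 0"
    using \<psi>(2)[of 0] inv[OF f0] ball_involution_center[OF f0] by (simp add: \<omega>_def)
  ultimately have "\<exists>D. Vector_Spaces.linear (*s) (*s) D \<and> (\<forall>w. norm w < 1 \<longrightarrow> \<omega> w = D w)
      \<and> (\<forall>w. norm (D w) = norm w)"
    using Cartan_linear[of \<omega>] by metis
  then obtain D where D: "Vector_Spaces.linear (*s) (*s) D"
    "\<And>w. norm w < 1 \<Longrightarrow> \<omega> w = D w" "\<And>w. norm (D w) = norm w"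
    by blast
  have "?\<phi> (f (cis \<theta> *s z)) = D (?\<phi> (f z))" if z: "norm z < 1" for z
  proof -
    have fz: "norm (f z) < 1" using f z by (rule holomorphic_ball_mapD)
    then have "norm (?\<phi> (f z)) < 1" by (rule norm_ball_involution_less[OF f0 refl])
    from D(2)[OF this] show ?thesis
      by (simp add: \<omega>_def inv[OF fz] \<psi>(2)[OF z])
  qed
  with D(1,3) show ?thesis
    by (intro exI[of _ D] conjI allI impI) simp_all
qed

theorem corollary1p1:
  fixes f :: "complex^'n \<Rightarrow> complex^'m"
  assumes "holomorphic_ball_map f"
    and "(*v) ` (unitary_center :: (complex^'n^'n) set) \<subseteq> Gamma_group f"
  shows "\<exists>g :: complex^'n \<Rightarrow> complex^'m.
    holomorphic_ball_map g \<and> polynomial_map g \<and> spherically_equivalent f g"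
proof -
  let ?\<phi> = "ball_involution (f 0)"
  have f0: "norm (f 0) < 1" using holomorphic_ball_mapD[OF assms(1), of 0] by simp
  have hol: "holomorphic_ball_map (?\<phi> \<circ> f)"
    by (rule holomorphic_ball_map_compose[OF holomorphic_ball_involution[OF f0 refl] assms(1)])
  obtain G where G: "polynomial_map G" "\<And>z. norm z < 1 \<Longrightarrow> G z = (?\<phi> \<circ> f) z"
    using finite_expansion_polynomial[OF hol finitely_many_hom_components
        [OF hol rotations_become_linear[OF assms]]] by metis
  have "holomorphic_ball_map G"
    using hol G(2) by (rule holomorphic_ball_map_cong)
  moreover have "spherically_equivalent f G"
    unfolding spherically_equivalent_def
  proof (intro bexI ballI)
    fix z :: "complex^'n" assume "z \<in> unit_ball"
    then have z: "norm z < 1" by simp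
    show "?\<phi> (G z) = f z"
      using ball_involution_involutive[OF f0 refl holomorphic_ball_mapD[OF assms(1) z]]
      by (simp add: G(2)[OF z])
  qed (use Aut_ball_id Aut_ball_involution[OF f0] in auto)
  ultimately show ?thesis using G(1) by blast
qed

end
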